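(* Let $P$ be an arbitrary finite pattern in $\mathbb{C}$ with $|P|\ge3$, and let $m=m(n)\ge 3$ be a function with $m(n)\rightarrow\infty$ as $n\to\infty$. Then for every $\varepsilon>0$ there is a threshold $N_0=N_0(\varepsilon,P)$ such that \[ S_P(n,m)\geq n^{2-\varepsilon}\quad\text{for every } n\geq N_0. \]
   Context: Sets $A,B\subseteq\mathbb{C}$ are similar if $B=zA+w$ for some $z,w\in\mathbb{C}$, $z\neq0$. $S_P(Q)$ is the number of subsets of $Q$ similar to $P$. $S_P(n,m)$ is the maximum of $S_P(Q)$ over all $n$-point sets $Q\subseteq\mathbb{C}$ with no $m$ collinear points.
   Formalization: The threshold N_0 may depend on the function m as well as on ε and P; a threshold depending only on ε and P fails for collinear P, since m(n) may equal 3 for arbitrarily long, where S_P(n,3)=0. *)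

theory Defs
  imports "HOL-Analysis.Analysis"
begin

definition similar_sets :: "complex set \<Rightarrow> complex set \<Rightarrow> bool" where
  "similar_sets A B \<longleftrightarrow> (\<exists>z w. z \<noteq> 0 \<and> B = (\<lambda>a. z * a + w) ` A)"

definition similar_copies :: "complex set \<Rightarrow> complex set \<Rightarrow> nat" where
  "similar_copies P Q = card {A. A \<subseteq> Q \<and> similar_sets P A}"

definition no_collinear :: "nat \<Rightarrow> complex set \<Rightarrow> bool" where
  "no_collinear m Q \<longleftrightarrow> \<not> (\<exists>T\<subseteq>Q. finite T \<and> card T = m \<and> collinear T)"

text \<open>
  The set below is finite, as its elements are at most $2^n$. It is nonempty when
  $m \geq 3$ (take $n$ points on a parabola), so \<^const>\<open>Max\<close> is then a genuine maximum.
\<close>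

definition max_similar_copies :: "complex set \<Rightarrow> nat \<Rightarrow> nat \<Rightarrow> nat" where
  "max_similar_copies P n m =
     Max {similar_copies P Q | Q. finite Q \<and> card Q = n \<and> no_collinear m Q}"

end

theory Submission
  imports Defs "HOL-Real_Asymp.Real_Asymp"
begin

text \<open>
  Iterating \<open>A \<mapsto> {a + z p | a, z \<in> A, p \<in> P}\<close> from \<open>{0, 1}\<close> yields sets whose cardinality grows
  only like \<open>exp (poly s)\<close>, because all elements are combinations of polynomially many monomials
  in \<open>P\<close>. Hence two consecutive sets \<open>B \<subseteq> A\<close> satisfy \<open>|A| \<le> |B|\<^bsup>1 + \<delta>\<^esup>\<close>.
  For generic \<open>v\<^sub>1, \<dots>, v\<^sub>t\<close> the Minkowski sum \<open>v\<^sub>1 A + \<dots> + v\<^sub>t A\<close> has \<open>|A|\<^bsup>t\<^esup>\<close> points and contains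
  \<open>a + z P\<close> for all \<open>a, z\<close> in \<open>v\<^sub>1 B + \<dots> + v\<^sub>t B\<close>. A line meets it in at most
  \<open>|A|\<close> points, whatever \<open>t\<close> is: for generic \<open>v\<^sub>i\<close>, collinearity of points forces them to be collinear
  already as vectors over \<open>A\<close>. Generic points fill up to an arbitrary cardinality \<open>n\<close>.
\<close>

section \<open>Collinearity in the complex plane\<close>

text \<open>Up to sign, this imaginary part is the determinant of \<open>y - x\<close> and
  \<open>z - x\<close> as real vectors. It turns collinearity into a polynomial equation that a
  generic choice can rule out.\<close>

lemma collinear_imp_Im_eq_0:
  assumes "collinear T" "x \<in> T" "y \<in> T" "z \<in> T"
  shows "Im ((y - x) * cnj (z - x)) = 0"
proof -
  obtain u where u: "\<And>x y. x \<in> T \<Longrightarrow> y \<in> T \<Longrightarrow> \<exists>c. x - y = c *\<^sub>R u"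
    using assms(1) unfolding collinear_def by blast
  obtain c d where "y - x = c *\<^sub>R u" "z - x = d *\<^sub>R u"
    using u assms by meson
  then show ?thesis by simp
qed

lemma collinear_if_real_multiples:
  fixes x e :: "'a::real_vector"
  assumes "\<And>y. y \<in> S \<Longrightarrow> \<exists>r. y - x = r *\<^sub>R e"
  shows "collinear S"
  unfolding collinear_def
proof (intro exI[of _ e] ballI)
  fix y z assume "y \<in> S" "z \<in> S"
  then obtain r s where r: "y - x = r *\<^sub>R e" and s: "z - x = s *\<^sub>R e"
    using assms by meson
  have "y - z = (r - s) *\<^sub>R e"
    by (simp add: scaleR_diff_left flip: r s)
  then show "\<exists>c. y - z = c *\<^sub>R e" by blast
qed

lemma real_multiple_if_Im_eq_0:
  assumes "Im (d * cnj e) = 0" "e \<noteq> 0"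
  obtains r :: real where "d = r *\<^sub>R e"
proof
  have "d * cnj e = of_real (Re (d * cnj e))"
    using assms(1) by (simp add: complex_eq_iff)
  then have "d * (cnj e * e) = of_real (Re (d * cnj e)) * e"
    by (metis mult.assoc)
  moreover have "cnj e * e = of_real ((cmod e)\<^sup>2)"
    by (metis complex_norm_square mult.commute)
  ultimately show "d = (Re (d * cnj e) / (cmod e)\<^sup>2) *\<^sub>R e"
    using assms(2) by (simp add: scaleR_conv_of_real field_simps)
qed

text \<open>Lets a construction made for one fixed bound serve all sufficiently large values of
  m(n).\<close>

lemma no_collinear_mono:
  assumes "no_collinear k Q" "k \<le> m"
  shows "no_collinear m Q"
  unfolding no_collinear_def
proof clarify
  fix T assume T: "T \<subseteq> Q" "finite T" "m = card T" "collinear T"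
  then obtain T' where "T' \<subseteq> T" "card T' = k"
    using assms(2) obtain_subset_with_card_n by metis
  then show False
    using T assms(1) collinear_subset[of T T'] finite_subset[of T' T]
    unfolding no_collinear_def by blast
qed

section \<open>Generic points\<close>

text \<open>Restricted to the parabola \<open>v = \<tau> + i \<tau>\<^sup>2\<close>, the functions \<open>1\<close>, \<open>Re v\<close>, \<open>Im v\<close>, \<open>|v|\<^sup>2\<close> stay
  linearly independent polynomials in \<open>\<tau>\<close>, so each nontrivial condition excludes finitely many \<open>\<tau>\<close>.\<close>

lemma ex_generic_point:
  fixes S :: "(real \<times> complex \<times> real) set"
  assumes "finite S"
  obtains v where "\<And>c0 c c1. (c0, c, c1) \<in> S \<Longrightarrow> c0 + Im (v * c) + (cmod v)\<^sup>2 * c1 = 0 \<Longrightarrow>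
                     c0 = 0 \<and> c = 0 \<and> c1 = 0"
proof -
  \<comment> \<open>At v = \<tau> + i \<tau>^2 one has Im (v c) = \<tau> Im c + \<tau>^2 Re c and
    |v|^2 = \<tau>^2 + \<tau>^4. The quartic coefficient isolates \<open>c1\<close>, after which the
    quadratic one yields \<open>Re c\<close>.\<close>
  define f :: "real \<times> complex \<times> real \<Rightarrow> real poly"
    where "f = (\<lambda>(c0, c, c1). [:c0, Im c, Re c + c1, 0, c1:])"
  have f0: "f (c0, c, c1) = 0 \<Longrightarrow> c0 = 0 \<and> c = 0 \<and> c1 = 0" for c0 c c1
    by (auto simp: f_def complex_eq_iff)
  have "finite (\<Union>p\<in>f ` S - {0}. {\<tau>. poly p \<tau> = 0})"
    using assms by (auto intro: poly_roots_finite)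
  then obtain \<tau> where \<tau>: "\<tau> \<notin> (\<Union>p\<in>f ` S - {0}. {\<tau>. poly p \<tau> = 0})"
    using ex_new_if_finite infinite_UNIV_char_0 by blast
  show thesis
  proof (rule that)
    fix c0 c c1
    assume S: "(c0, c, c1) \<in> S"
      and "c0 + Im (Complex \<tau> (\<tau>\<^sup>2) * c) + (cmod (Complex \<tau> (\<tau>\<^sup>2)))\<^sup>2 * c1 = 0"
    then have "poly (f (c0, c, c1)) \<tau> = 0"
      unfolding cmod_power2 by (simp add: f_def algebra_simps power2_eq_square)
    with \<tau> S have "f (c0, c, c1) = 0" by blast
    then show "c0 = 0 \<and> c = 0 \<and> c1 = 0" by (rule f0)
  qed
qed

text \<open>For generic v, collinearity of points x + v y splits into separate equations for the
  coefficients of 1, v and |v|^2. These force a collinear set either to lie over a single point of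
  \<open>Q\<close>, hence to have at most \<open>card A\<close> points, or to project injectively
  onto a collinear subset of \<open>Q\<close>. So the bound \<open>m\<close> survives unchanged,
  which is what allows iteration.\<close>

lemma ex_generic_translate_scale:
  fixes Q A :: "complex set"
  assumes "finite Q" "finite A" "no_collinear m Q" "card A < m" "2 \<le> m"
  obtains v where "inj_on (\<lambda>(x, y). x + v * y) (Q \<times> A)"
    "no_collinear m ((\<lambda>(x, y). x + v * y) ` (Q \<times> A))"
proof -
  define D where "D = (\<lambda>(x, y). x - y) ` (Q \<times> Q)"
  define D' where "D' = (\<lambda>(x, y). x - y) ` (A \<times> A)"
  \<comment> \<open>The first family encodes the coincidence d + v d' = 0, the second the expansion
    of Im ((d + v d') cnj (e + v e')) in terms of 1, v and |v|^2.\<close>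
  define S where "S = (\<lambda>(d, d'). (Im d, d', 0 :: real)) ` (D \<times> D') \<union>
    (\<lambda>(d, d', e, e'). (Im (d * cnj e), d' * cnj e - cnj d * e', Im (d' * cnj e'))) ` (D \<times> D' \<times> D \<times> D')"
  have "finite S"
    using assms unfolding S_def D_def D'_def by blast
  then obtain v where v: "\<And>c0 c c1. (c0, c, c1) \<in> S \<Longrightarrow> c0 + Im (v * c) + (cmod v)\<^sup>2 * c1 = 0 \<Longrightarrow>
                     c0 = 0 \<and> c = 0 \<and> c1 = 0"
    using ex_generic_point by blast
  have D: "x - y \<in> D" if "x \<in> Q" "y \<in> Q" for x y
    using that unfolding D_def by force
  have D': "x - y \<in> D'" if "x \<in> A" "y \<in> A" for x y
    using that unfolding D'_def by force
  let ?f = "\<lambda>(x, y). x + v * y"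
  have inj: "inj_on ?f (Q \<times> A)"
  proof (rule inj_onI, clarify)
    fix x a y b assume *: "x \<in> Q" "a \<in> A" "y \<in> Q" "b \<in> A" "x + v * a = y + v * b"
    then have eq: "(x - y) + v * (a - b) = 0" by (simp add: algebra_simps)
    \<comment> \<open>The imaginary part of the coincidence is enough: it forces
      \<open>a - b = 0\<close>, and then the full equation gives x = y.\<close>
    have "(Im (x - y), a - b, 0) \<in> S"
      using * D D' unfolding S_def by (intro UnI1 image_eqI[of _ _ "(x - y, a - b)"]) auto
    moreover have "Im (x - y) + Im (v * (a - b)) + (cmod v)\<^sup>2 * 0 = 0"
      using arg_cong[OF eq, of Im] by simp
    ultimately have "a - b = 0" using v by blast
    with eq show "x = y \<and> a = b" by simp
  qed
  have "no_collinear m (?f ` (Q \<times> A))"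
    unfolding no_collinear_def
  proof clarify
    fix T assume "T \<subseteq> ?f ` (Q \<times> A)" "finite T" and m: "m = card T" and col: "collinear T"
    then obtain U where U: "U \<subseteq> Q \<times> A" "T = ?f ` U"
      by (meson subset_imageE)
    have cardU: "card U = m"
      using U m inj by (metis card_image inj_on_subset)
    have finU: "finite U"
      using U assms finite_subset by blast
    obtain x a y b where xy: "(x, a) \<in> U" "(y, b) \<in> U" "(x, a) \<noteq> (y, b)"
    proof -
      have "\<not> card U \<le> Suc 0" using cardU assms by simp
      then show thesis using that card_le_Suc0_iff_eq[OF finU] by (metis surj_pair)
    qed
    define e e' where "e = y - x" "e' = b - a"
    have key: "Im ((w - x) * cnj e) = 0 \<and> (c - a) * cnj e = cnj (w - x) * e'"
      if "(w, c) \<in> U" for w c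
    proof -
      have "(Im ((w - x) * cnj e), (c - a) * cnj e - cnj (w - x) * e', Im ((c - a) * cnj e')) \<in> S"
      proof -
        have "(w - x, c - a, e, e') \<in> D \<times> D' \<times> D \<times> D'"
          using subsetD[OF U(1) that] subsetD[OF U(1) xy(1)] subsetD[OF U(1) xy(2)]
          unfolding e_e'_def by (auto intro!: D D')
        then show ?thesis unfolding S_def by (intro UnI2 image_eqI[of _ _ "(w - x, c - a, e, e')"]) auto
      qed
      moreover have "Im ((w - x) * cnj e) + Im (v * ((c - a) * cnj e - cnj (w - x) * e'))
          + (cmod v)\<^sup>2 * Im ((c - a) * cnj e') = 0"
      proof -
        have "Im (((w + v * c) - (x + v * a)) * cnj ((y + v * b) - (x + v * a))) = 0"
          using imageI[OF that, of ?f] imageI[OF xy(1), of ?f] imageI[OF xy(2), of ?f]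
          unfolding U(2)[symmetric] by (intro collinear_imp_Im_eq_0[OF col]) auto
        moreover have "(w + v * c) - (x + v * a) = (w - x) + v * (c - a)"
          "(y + v * b) - (x + v * a) = e + v * e'"
          by (simp_all add: e_e'_def algebra_simps)
        moreover have "Im ((d + v * d') * cnj (e + v * e')) =
            Im (d * cnj e) + Im (v * (d' * cnj e - cnj d * e')) + (cmod v)\<^sup>2 * Im (d' * cnj e')" for d d'
          unfolding cmod_power2 by (simp add: algebra_simps power2_eq_square)
        ultimately show ?thesis by metis
      qed
      ultimately show ?thesis using v by (metis eq_iff_diff_eq_0)
    qed
    show False
    proof (cases "e = 0")
      \<comment> \<open>The second equation of \<open>key\<close> becomes cnj (w - x) e' = 0, so all
        of \<open>U\<close> lies over x.\<close>
      case True
      then have "e' \<noteq> 0" using xy unfolding e_e'_def by auto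
      then have fst_eq: "w = x" if "(w, c) \<in> U" for w c
        using key[OF that] True by auto
      then have "inj_on snd U"
        by (auto intro!: inj_onI)
      then have "card U \<le> card A"
        using U assms by (intro card_inj_on_le) auto
      then show False using cardU assms by simp
    next
      \<comment> \<open>Now the second equation of \<open>key\<close> determines c from w, and the
        first puts w on the real line through x in direction \<open>e\<close>.\<close>
      case False
      have "inj_on fst U"
      proof (rule inj_onI, clarsimp)
        fix w c c' assume "(w, c) \<in> U" "(w, c') \<in> U"
        then have "(c - a) * cnj e = (c' - a) * cnj e" using key by metis
        then show "c = c'" using False by simp
      qed
      then have "card (fst ` U) = m" using cardU by (simp add: card_image)
      moreover have "collinear (fst ` U)"
      proof (rule collinear_if_real_multiples)
        fix w assume "w \<in> fst ` U"
        then have "Im ((w - x) * cnj e) = 0" using key by force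
        then show "\<exists>r. w - x = r *\<^sub>R e" using real_multiple_if_Im_eq_0 False by metis
      qed
      moreover have "fst ` U \<subseteq> Q" using U by auto
      ultimately show False
        using assms(3) finU unfolding no_collinear_def by blast
    qed
  qed
  with inj show thesis using that by blast
qed

text \<open>A generic v avoids all lines through two points of \<open>Q\<close>, so a collinear set
  containing v has at most two points; this is where \<open>3 \<le> m\<close> enters.\<close>

lemma ex_insert_no_collinear:
  assumes "finite Q" "no_collinear m Q" "3 \<le> m"
  obtains v where "v \<notin> Q" "no_collinear m (insert v Q)"
proof -
  \<comment> \<open>The first family makes Im v differ from Im x for all x in \<open>Q\<close>,
    hence v is new; the second says that v lies on the line through x and y.\<close>
  define S where "S = (\<lambda>x. (- Im x, 1 :: complex, 0 :: real)) ` Q \<union>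
    (\<lambda>(x, y). (- Im (x * cnj (y - x)), cnj (y - x), 0)) ` (Q \<times> Q)"
  have "finite S" using assms unfolding S_def by blast
  then obtain v where v: "\<And>c0 c c1. (c0, c, c1) \<in> S \<Longrightarrow> c0 + Im (v * c) + (cmod v)\<^sup>2 * c1 = 0 \<Longrightarrow>
                     c0 = 0 \<and> c = 0 \<and> c1 = 0"
    using ex_generic_point by blast
  have "v \<notin> Q"
  proof
    assume "v \<in> Q"
    then have "(- Im v, 1, 0) \<in> S" unfolding S_def by blast
    then show False using v by fastforce
  qed
  moreover have "no_collinear m (insert v Q)"
    unfolding no_collinear_def
  proof clarify
    fix T assume T: "T \<subseteq> insert v Q" "finite T" "m = card T" "collinear T"
    show False
    proof (cases "v \<in> T")
      case False
      then show False using T assms(2) unfolding no_collinear_def by blast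
    next
      case True
      then have "\<not> card (T - {v}) \<le> Suc 0" using T assms(3) by simp
      then obtain x y where xy: "x \<in> T" "y \<in> T" "x \<noteq> v" "y \<noteq> v" "x \<noteq> y"
        using T(2) by (subst (asm) card_le_Suc0_iff_eq) auto
      then have "x \<in> Q" "y \<in> Q" using T by auto
      then have "(- Im (x * cnj (y - x)), cnj (y - x), 0) \<in> S" unfolding S_def by force
      moreover have "Im ((v - x) * cnj (y - x)) = 0"
        using collinear_imp_Im_eq_0[OF T(4)] xy True by blast
      then have "- Im (x * cnj (y - x)) + Im (v * cnj (y - x)) + (cmod v)\<^sup>2 * 0 = 0"
        by (simp add: algebra_simps)
      ultimately have "cnj (y - x) = 0" using v by blast
      then show False using xy by simp
    qed
  qed
  ultimately show thesis using that by blast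
qed

lemma ex_superset_no_collinear:
  assumes "finite Q" "no_collinear m Q" "3 \<le> m" "card Q \<le> n"
  obtains Q' where "Q \<subseteq> Q'" "finite Q'" "card Q' = n" "no_collinear m Q'"
proof -
  have "\<exists>Q'. Q \<subseteq> Q' \<and> finite Q' \<and> card Q' = n \<and> no_collinear m Q'"
    using assms(4)
  proof (induction n rule: dec_induct)
    case base
    then show ?case using assms by blast
  next
    case (step n)
    then obtain Q' where Q': "Q \<subseteq> Q'" "finite Q'" "card Q' = n" "no_collinear m Q'" by blast
    then obtain v where "v \<notin> Q'" "no_collinear m (insert v Q')"
      using ex_insert_no_collinear assms(3) by metis
    then show ?case using Q' by (intro exI[of _ "insert v Q'"]) auto
  qed
  then show thesis using that by blast
qed

section \<open>Sets of slow growth\<close>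

fun affine_closure_step :: "complex set \<Rightarrow> nat \<Rightarrow> complex set" where
  "affine_closure_step P 0 = {0, 1}"
| "affine_closure_step P (Suc s) =
     (\<lambda>(a, z, p). a + z * p) ` (affine_closure_step P s \<times> affine_closure_step P s \<times> P)"

definition nat_combinations :: "complex set \<Rightarrow> nat \<Rightarrow> complex set" where
  "nat_combinations M N = {z. \<exists>c. (\<forall>u. c u \<le> N) \<and> z = (\<Sum>u\<in>M. of_nat (c u) * u)}"

text \<open>Each exponent is bounded separately, so the exponent vectors form a finite function
  space of size polynomial in s. Distinct vectors may give the same complex number, which only helps
  the upper bound.\<close>

definition monomials :: "complex set \<Rightarrow> nat \<Rightarrow> complex set" where
  "monomials P s = (\<lambda>\<alpha>. \<Prod>p\<in>P. p ^ \<alpha> p) ` (P \<rightarrow>\<^sub>E {..s})"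

lemma finite_monomials: "finite P \<Longrightarrow> finite (monomials P s)"
  unfolding monomials_def by (intro finite_imageI finite_PiE) auto

lemma card_monomials_le:
  assumes "finite P"
  shows "card (monomials P s) \<le> (s + 1) ^ card P"
proof -
  have "card (monomials P s) \<le> card (P \<rightarrow>\<^sub>E {..s})"
    unfolding monomials_def using assms by (intro card_image_le finite_PiE) auto
  then show ?thesis using assms by (simp add: card_PiE)
qed

lemma monomials_mono: "s \<le> t \<Longrightarrow> monomials P s \<subseteq> monomials P t"
  unfolding monomials_def by (intro image_mono PiE_mono) auto

lemma mult_mem_monomials:
  assumes "finite P" "p \<in> P" "u \<in> monomials P s"
  shows "p * u \<in> monomials P (Suc s)"
proof -
  obtain \<alpha> where \<alpha>: "\<alpha> \<in> P \<rightarrow>\<^sub>E {..s}" "u = (\<Prod>p\<in>P. p ^ \<alpha> p)"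
    using assms(3) unfolding monomials_def by blast
  have "(\<Prod>q\<in>P. q ^ (\<alpha>(p := Suc (\<alpha> p))) q) = p * u"
    unfolding \<alpha>(2) using assms by (simp add: prod.remove[of P p])
  moreover have "\<alpha>(p := Suc (\<alpha> p)) \<in> P \<rightarrow>\<^sub>E {..Suc s}"
    using \<alpha>(1) assms(2) by (auto simp: PiE_iff extensional_def le_SucI)
  ultimately show ?thesis
    unfolding monomials_def by (intro image_eqI[of _ _ "\<alpha>(p := Suc (\<alpha> p))"]) simp_all
qed

lemma nat_combinations_finite_card:
  assumes "finite M"
  shows "finite (nat_combinations M N)" "card (nat_combinations M N) \<le> (N + 1) ^ card M"
proof -
  have sub: "nat_combinations M N \<subseteq> (\<lambda>c. \<Sum>u\<in>M. of_nat (c u) * u) ` (M \<rightarrow>\<^sub>E {..N})"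
  proof
    fix z assume "z \<in> nat_combinations M N"
    then obtain c where "\<forall>u. c u \<le> N" "z = (\<Sum>u\<in>M. of_nat (c u) * u)"
      unfolding nat_combinations_def by blast
    then show "z \<in> (\<lambda>c. \<Sum>u\<in>M. of_nat (c u) * u) ` (M \<rightarrow>\<^sub>E {..N})"
      by (intro image_eqI[of _ _ "restrict c M"]) auto
  qed
  have fin: "finite (M \<rightarrow>\<^sub>E {..N})" using assms by (intro finite_PiE) auto
  then show "finite (nat_combinations M N)" using sub by (meson finite_imageI finite_subset)
  have "card (nat_combinations M N) \<le> card (M \<rightarrow>\<^sub>E {..N})"
    using sub fin by (meson card_image_le card_mono finite_imageI le_trans)
  then show "card (nat_combinations M N) \<le> (N + 1) ^ card M"
    using assms by (simp add: card_PiE)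
qed

lemma nat_combinations_add:
  assumes "x \<in> nat_combinations M N" "y \<in> nat_combinations M N'"
  shows "x + y \<in> nat_combinations M (N + N')"
proof -
  obtain c d where "\<forall>u. c u \<le> N" "x = (\<Sum>u\<in>M. of_nat (c u) * u)"
    "\<forall>u. d u \<le> N'" "y = (\<Sum>u\<in>M. of_nat (d u) * u)"
    using assms unfolding nat_combinations_def by blast
  then show ?thesis unfolding nat_combinations_def
    by (intro CollectI exI[of _ "\<lambda>u. c u + d u"]) (simp add: add_mono sum.distrib algebra_simps)
qed

lemma nat_combinations_mono:
  assumes "M \<subseteq> M'" "finite M'"
  shows "nat_combinations M N \<subseteq> nat_combinations M' N"
proof
  fix x assume "x \<in> nat_combinations M N"
  then obtain c where c: "\<forall>u. c u \<le> N" "x = (\<Sum>u\<in>M. of_nat (c u) * u)"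
    unfolding nat_combinations_def by blast
  have "x = (\<Sum>u\<in>M'. of_nat (if u \<in> M then c u else 0) * u)"
    unfolding c(2) using assms by (intro sum.mono_neutral_cong_left) auto
  then show "x \<in> nat_combinations M' N" unfolding nat_combinations_def
    using c(1) by (intro CollectI exI[of _ "\<lambda>u. if u \<in> M then c u else 0"]) auto
qed

lemma nat_combinations_mult:
  assumes "x \<in> nat_combinations M N" "p \<noteq> 0"
  shows "x * p \<in> nat_combinations ((*) p ` M) N"
proof -
  obtain c where c: "\<forall>u. c u \<le> N" "x = (\<Sum>u\<in>M. of_nat (c u) * u)"
    using assms unfolding nat_combinations_def by blast
  have "inj_on ((*) p) M" using assms(2) by (auto intro: inj_onI)
  then have "(\<Sum>w\<in>(*) p ` M. of_nat (c (w / p)) * w) = (\<Sum>u\<in>M. of_nat (c u) * (p * u))"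
    using assms(2) by (subst sum.reindex) auto
  also have "\<dots> = x * p"
    unfolding c(2) sum_distrib_right by (intro sum.cong) auto
  finally have "x * p = (\<Sum>w\<in>(*) p ` M. of_nat (c (w / p)) * w)" by simp
  then show ?thesis unfolding nat_combinations_def
    using c(1) by (intro CollectI exI[of _ "\<lambda>w. c (w / p)"]) auto
qed

text \<open>In a + z p, multiplication by p raises one exponent by 1 and keeps the coefficients,
  while the addition at most doubles the coefficient bound.\<close>

lemma affine_closure_step_subset:
  assumes "finite P"
  shows "affine_closure_step P s \<subseteq> nat_combinations (monomials P s) (2 ^ s)"
proof (induction s)
  case 0
  have "monomials P 0 = {1}"
  proof -
    have "(\<Prod>p\<in>P. p ^ \<alpha> p) = 1" if "\<alpha> \<in> P \<rightarrow>\<^sub>E {..0::nat}" for \<alpha>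
      using that by (intro prod.neutral) auto
    moreover have "P \<rightarrow>\<^sub>E {..0::nat} \<noteq> {}" by (simp add: PiE_eq_empty_iff)
    ultimately show ?thesis unfolding monomials_def by auto
  qed
  moreover have "(0::complex) = (\<Sum>u\<in>{1}. of_nat 0 * u)" "(1::complex) = (\<Sum>u\<in>{1}. of_nat 1 * u)"
    by simp_all
  ultimately show ?case unfolding nat_combinations_def
    by (auto intro: exI[of _ "\<lambda>_. 0"] exI[of _ "\<lambda>_. 1"])
next
  case (Suc s)
  let ?L = "nat_combinations (monomials P (Suc s)) (2 ^ s)"
  have L: "nat_combinations (monomials P s) (2 ^ s) \<subseteq> ?L"
    by (intro nat_combinations_mono monomials_mono finite_monomials assms) simp
  have mult: "z * p \<in> ?L" if "z \<in> nat_combinations (monomials P s) (2 ^ s)" "p \<in> P" for z p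
  proof (cases "p = 0")
    \<comment> \<open>Multiplication by 0 is not injective on monomials, so the reindexing of
      coefficients fails; the product is 0 and has zero coefficients.\<close>
    case True
    then show ?thesis unfolding nat_combinations_def by (auto intro: exI[of _ "\<lambda>_. 0"])
  next
    case False
    have "(*) p ` monomials P s \<subseteq> monomials P (Suc s)"
      using mult_mem_monomials[OF assms that(2)] by blast
    then show ?thesis
      using nat_combinations_mult[OF that(1) False] nat_combinations_mono
        finite_monomials[OF assms] by blast
  qed
  show ?case
  proof
    fix x assume "x \<in> affine_closure_step P (Suc s)"
    then obtain a z p where "x = a + z * p" "p \<in> P"
      "a \<in> affine_closure_step P s" "z \<in> affine_closure_step P s" by auto
    then have "a \<in> ?L" "z * p \<in> ?L" using Suc L mult by blast+
    then show "x \<in> nat_combinations (monomials P (Suc s)) (2 ^ Suc s)"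
      unfolding \<open>x = a + z * p\<close> power_Suc mult_2 by (rule nat_combinations_add)
  qed
qed

lemma affine_closure_step_finite_card:
  assumes "finite P"
  shows "finite (affine_closure_step P s)"
    "card (affine_closure_step P s) \<le> (2 ^ s + 1) ^ ((s + 1) ^ card P)"
proof -
  let ?L = "nat_combinations (monomials P s) (2 ^ s)"
  note L = nat_combinations_finite_card[OF finite_monomials[OF assms]]
  show "finite (affine_closure_step P s)"
    using affine_closure_step_subset[OF assms] L(1) finite_subset by blast
  have "card (affine_closure_step P s) \<le> card ?L"
    using affine_closure_step_subset[OF assms] L(1) by (intro card_mono)
  also have "\<dots> \<le> (2 ^ s + 1) ^ card (monomials P s)" by (rule L(2))
  also have "\<dots> \<le> (2 ^ s + 1) ^ ((s + 1) ^ card P)"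
    using card_monomials_le[OF assms] by (intro power_increasing) auto
  finally show "card (affine_closure_step P s) \<le> (2 ^ s + 1) ^ ((s + 1) ^ card P)" .
qed

text \<open>Choosing z = 0 in a + z p returns a, so a set containing 0 is included in its successor;
  this in turn keeps 0 and 1 inside.\<close>

lemma
  assumes "P \<noteq> {}"
  shows zero_one_mem_affine_closure_step: "{0, 1} \<subseteq> affine_closure_step P s"
    and affine_closure_step_subset_Suc: "affine_closure_step P s \<subseteq> affine_closure_step P (Suc s)"
proof -
  have sub: "affine_closure_step P s \<subseteq> affine_closure_step P (Suc s)"
    if "0 \<in> affine_closure_step P s" for s
  proof
    fix a assume "a \<in> affine_closure_step P s"
    moreover obtain p where "p \<in> P" using assms by blast
    ultimately have "(a, 0, p) \<in> affine_closure_step P s \<times> affine_closure_step P s \<times> P"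
      using that by blast
    then show "a \<in> affine_closure_step P (Suc s)" by force
  qed
  have z: "{0, 1} \<subseteq> affine_closure_step P s" for s
  proof (induction s)
    case (Suc s)
    then show ?case using sub[of s] by blast
  qed simp
  then show "{0, 1} \<subseteq> affine_closure_step P s" .
  show "affine_closure_step P s \<subseteq> affine_closure_step P (Suc s)"
    using sub z by simp
qed

lemma card_affine_closure_step_ge_2:
  assumes "finite P" "P \<noteq> {}"
  shows "2 \<le> card (affine_closure_step P s)"
proof -
  have "card {0, 1 :: complex} \<le> card (affine_closure_step P s)"
    using zero_one_mem_affine_closure_step assms affine_closure_step_finite_card(1)
    by (intro card_mono) auto
  then show ?thesis by simp
qed

text \<open>If every step exceeded the power 1 + \<delta>, the logarithm of the cardinality would
  grow at least like (1 + \<delta>)^s, starting from ln 2. The count of bounded combinations of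
  monomials makes it at most polynomial in s.\<close>

lemma ex_slow_growth_step:
  fixes \<delta> :: real
  assumes "finite P" "P \<noteq> {}" "\<delta> > 0"
  shows "\<exists>s. real (card (affine_closure_step P (Suc s))) \<le> real (card (affine_closure_step P s)) powr (1 + \<delta>)"
proof (rule ccontr)
  define l where "l s = ln (real (card (affine_closure_step P s)))" for s
  note ge2 = card_affine_closure_step_ge_2[OF assms(1,2)]
  have pos: "0 < real (card (affine_closure_step P s))" for s
    using ge2[of s] by simp
  assume "\<not> ?thesis"
  then have less: "real (card (affine_closure_step P s)) powr (1 + \<delta>) < real (card (affine_closure_step P (Suc s)))" for s
    by (simp add: not_le del: affine_closure_step.simps)
  have step: "(1 + \<delta>) * l s \<le> l (Suc s)" for s
  proof -
    have "(1 + \<delta>) * l s = ln (real (card (affine_closure_step P s)) powr (1 + \<delta>))"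
      unfolding l_def using pos[of s] by (simp add: ln_powr)
    also have "\<dots> \<le> l (Suc s)"
      unfolding l_def using less[of s] pos[of s] pos[of "Suc s"] by (subst ln_le_cancel_iff) auto
    finally show ?thesis .
  qed
  have lower: "(1 + \<delta>) ^ s * ln 2 \<le> l s" for s
  proof (induction s)
    case 0
    then show ?case by (simp add: l_def)
  next
    case (Suc s)
    then have "(1 + \<delta>) * ((1 + \<delta>) ^ s * ln 2) \<le> (1 + \<delta>) * l s"
      using assms(3) by (intro mult_left_mono) auto
    with step[of s] show ?case by (simp add: mult.assoc)
  qed
  have upper: "l s \<le> real (s + 1) ^ (card P + 1) * ln 2" for s
  proof -
    have "real (card (affine_closure_step P s)) \<le> (2 ^ s + 1) ^ ((s + 1) ^ card P)"
      using of_nat_mono[OF affine_closure_step_finite_card(2)[OF assms(1), of s], where 'a = real] by (simp add: add.commute)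
    then have "l s \<le> ln ((2 ^ s + 1) ^ ((s + 1) ^ card P))"
      unfolding l_def using pos[of s] by (meson less_le_trans ln_le_cancel_iff)
    also have "\<dots> = real (s + 1) ^ card P * ln (2 ^ s + 1)"
      by (subst ln_realpow) (auto simp: add_pos_pos)
    \<comment> \<open>Bounding the coefficient count by a power of 2 contributes one more linear
      factor, hence the exponent \<open>card P + 1\<close> in \<open>upper\<close>.\<close>
    also have "ln (2 ^ s + 1 :: real) \<le> ln (2 ^ (s + 1))"
      by (subst ln_le_cancel_iff) (auto simp: add_pos_pos)
    also have "ln (2 ^ (s + 1) :: real) = real (s + 1) * ln 2"
      by (subst ln_realpow) auto
    finally show ?thesis by (simp add: mult_ac mult_left_mono)
  qed
  have "eventually (\<lambda>s. real (s + 1) ^ (card P + 1) < (1 + \<delta>) ^ s) sequentially"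
    using assms(3) by real_asymp
  then obtain s where "real (s + 1) ^ (card P + 1) < (1 + \<delta>) ^ s"
    by (auto simp: eventually_sequentially)
  then have "real (s + 1) ^ (card P + 1) * ln 2 < (1 + \<delta>) ^ s * ln 2" by simp
  with lower[of s] upper[of s] show False by linarith
qed

section \<open>Counting similar copies\<close>

lemma finite_subsets_similar: "finite Q \<Longrightarrow> finite {A. A \<subseteq> Q \<and> similar_sets P A}"
  by (rule finite_subset[of _ "Pow Q"]) auto

lemma similar_copies_mono:
  assumes "finite Q'" "Q \<subseteq> Q'"
  shows "similar_copies P Q \<le> similar_copies P Q'"
  unfolding similar_copies_def using assms
  by (intro card_mono finite_subsets_similar) auto

lemma similar_copies_le_max:
  assumes "finite Q" "card Q = n" "no_collinear m Q"
  shows "similar_copies P Q \<le> max_similar_copies P n m"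
proof -
  let ?S = "{similar_copies P Q | Q. finite Q \<and> card Q = n \<and> no_collinear m Q}"
  have "?S \<subseteq> {..2 ^ n}"
  proof
    fix c assume "c \<in> ?S"
    then obtain Q where Q: "c = similar_copies P Q" "finite Q" "card Q = n" by blast
    have "similar_copies P Q \<le> card (Pow Q)"
      unfolding similar_copies_def using Q(2) by (intro card_mono) auto
    then show "c \<in> {..2 ^ n}"
      using Q by (simp add: card_Pow)
  qed
  then have "finite ?S" using finite_subset by blast
  then show ?thesis unfolding max_similar_copies_def using assms by (intro Max_ge) auto
qed

text \<open>A copy \<open>A = z P + a\<close> determines \<open>(a, z)\<close> once the images of two fixed points of \<open>P\<close> are chosen in
  \<open>A\<close>, so at most \<open>|P|\<^sup>2\<close> pairs give the same copy.\<close>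

lemma similar_copies_ge:
  assumes "finite P" "2 \<le> card P" "finite Q" "finite R"
    and cl: "\<And>a z p. a \<in> R \<Longrightarrow> z \<in> R \<Longrightarrow> p \<in> P \<Longrightarrow> a + z * p \<in> Q"
  shows "card R * (card R - 1) \<le> similar_copies P Q * (card P)\<^sup>2"
proof -
  obtain p q where pq: "p \<in> P" "q \<in> P" "p \<noteq> q"
    using assms(1,2) card_le_Suc0_iff_eq[of P] by force
  define C where "C = {A. A \<subseteq> Q \<and> similar_sets P A}"
  define W where "W = {A. A \<in> C \<and> finite A \<and> card A \<le> card P}"
  \<comment> \<open>The images of p and q determine the affine map, so tagging each copy with them
    makes \<open>F\<close> injective; a copy in \<open>W\<close> has at most (card P)^2
    tags.\<close>
  define F where "F = (\<lambda>(a, z). ((\<lambda>p. z * p + a) ` P, z * p + a, z * q + a))"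
  \<comment> \<open>A similarity needs z nonzero. Excluding 0 costs at most one element of
    \<open>R\<close>, whence the factor \<open>card R - 1\<close>.\<close>
  define D where "D = R \<times> (R - {0})"
  have finC: "finite C" unfolding C_def by (rule finite_subsets_similar[OF assms(3)])
  then have finW: "finite W" unfolding W_def by simp
  have "inj_on F D"
  proof (rule inj_onI, clarify)
    fix a z a' z' assume "F (a, z) = F (a', z')"
    then have eq: "z * p + a = z' * p + a'" "z * q + a = z' * q + a'" by (auto simp: F_def)
    then have "(z - z') * (p - q) = 0" by algebra
    with pq eq show "a = a' \<and> z = z'" by simp
  qed
  moreover have sub: "F ` D \<subseteq> Sigma W (\<lambda>A. A \<times> A)"
  proof (rule image_subsetI)
    fix x assume "x \<in> D"
    then obtain a z where x: "x = (a, z)" and az: "a \<in> R" "z \<in> R" "z \<noteq> 0" unfolding D_def by auto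
    then have "(\<lambda>p. z * p + a) ` P \<in> C"
      unfolding C_def similar_sets_def using cl by (auto simp: add.commute)
    then show "F x \<in> Sigma W (\<lambda>A. A \<times> A)"
      using pq assms(1) card_image_le[of P] unfolding x F_def W_def by auto
  qed
  moreover have fin: "finite (Sigma W (\<lambda>A. A \<times> A))"
    using finW unfolding W_def by (intro finite_SigmaI) auto
  ultimately have "card D \<le> card (Sigma W (\<lambda>A. A \<times> A))"
    by (metis card_inj_on_le)
  also have "\<dots> = (\<Sum>A\<in>W. card A * card A)"
    using finW unfolding W_def by (subst card_SigmaI) (auto simp: card_cartesian_product)
  also have "\<dots> \<le> (\<Sum>A\<in>W. (card P)\<^sup>2)"
    unfolding W_def power2_eq_square by (intro sum_mono mult_mono) auto
  also have "\<dots> = card W * (card P)\<^sup>2" by simp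
  also have "\<dots> \<le> card C * (card P)\<^sup>2"
    using finC unfolding W_def by (intro mult_right_mono card_mono) auto
  finally have "card D \<le> similar_copies P Q * (card P)\<^sup>2"
    unfolding similar_copies_def C_def .
  moreover have "card R * (card R - 1) \<le> card D"
    unfolding D_def using assms(4) by (auto simp: card_cartesian_product card_Diff_singleton_if)
  ultimately show ?thesis by linarith
qed

section \<open>Generic Minkowski sums and the bound for fixed P and \<delta>\<close>

lemma ex_minkowski_power:
  fixes A B P :: "complex set"
  assumes "finite A" "B \<subseteq> A" "card A < m" "2 \<le> m"
    and cl: "\<And>a z p. a \<in> B \<Longrightarrow> z \<in> B \<Longrightarrow> p \<in> P \<Longrightarrow> a + z * p \<in> A"
  shows "\<exists>Q R. finite Q \<and> R \<subseteq> Q \<and> card Q = card A ^ t \<and> card R = card B ^ t \<and> no_collinear m Q \<and>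
    (\<forall>a\<in>R. \<forall>z\<in>R. \<forall>p\<in>P. a + z * p \<in> Q)"
proof (induction t)
  case 0
  have "no_collinear m {0}"
    unfolding no_collinear_def
  proof clarify
    fix T :: "complex set" assume "T \<subseteq> {0}" "m = card T"
    then show False using assms(4) card_mono[of "{0::complex}" T] by simp
  qed
  then show ?case by (intro exI[of _ "{0}"]) auto
next
  case (Suc t)
  then obtain Q R where QR: "finite Q" "R \<subseteq> Q" "card Q = card A ^ t" "card R = card B ^ t"
    "no_collinear m Q" "\<And>a z p. a \<in> R \<Longrightarrow> z \<in> R \<Longrightarrow> p \<in> P \<Longrightarrow> a + z * p \<in> Q" by blast
  then obtain v where v: "inj_on (\<lambda>(x, y). x + v * y) (Q \<times> A)"
    "no_collinear m ((\<lambda>(x, y). x + v * y) ` (Q \<times> A))"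
    using ex_generic_translate_scale assms by metis
  let ?f = "\<lambda>(x, y). x + v * y"
  have sub: "R \<times> B \<subseteq> Q \<times> A" using QR assms by blast
  have "card (?f ` (Q \<times> A)) = card A ^ Suc t"
    using v QR by (simp add: card_image card_cartesian_product)
  moreover have "card (?f ` (R \<times> B)) = card B ^ Suc t"
    using inj_on_subset[OF v(1) sub] QR by (simp add: card_image card_cartesian_product)
  \<comment> \<open>Closure holds coordinatewise: (a + v b) + (c + v d) p = (a + c p) + v (b + d
    p).\<close>
  moreover have "x + z * p \<in> ?f ` (Q \<times> A)"
    if xz: "x \<in> ?f ` (R \<times> B)" "z \<in> ?f ` (R \<times> B)" and p: "p \<in> P" for x z p
  proof -
    obtain a b c d where abcd: "a \<in> R" "b \<in> B" "c \<in> R" "d \<in> B" "x = a + v * b" "z = c + v * d"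
      using xz by auto
    then have "x + z * p = ?f (a + c * p, b + d * p)" by (simp add: algebra_simps)
    moreover have "(a + c * p, b + d * p) \<in> Q \<times> A" using abcd QR(6) cl p by blast
    ultimately show ?thesis by (rule image_eqI)
  qed
  moreover have "finite (?f ` (Q \<times> A))" "?f ` (R \<times> B) \<subseteq> ?f ` (Q \<times> A)"
    using QR assms sub by auto
  ultimately show ?case using v(2)
    by (intro exI[of _ "?f ` (Q \<times> A)"] exI[of _ "?f ` (R \<times> B)"] conjI ballI) assumption+
qed

text \<open>\<open>M\<close> and \<open>q\<close> come from one slow growth step and do not depend
  on n; only the number t of summands grows with n. With b = \<open>card B\<close>, about b^(2t)
  copies arise, and q \<le> b^(1 + \<delta>) compares this with n.\<close>

lemma ex_constant_collinearity_bound: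
  fixes P :: "complex set" and \<delta> :: real
  assumes "finite P" "2 \<le> card P" "0 < \<delta>"
  shows "\<exists>M q. 0 < q \<and> (\<forall>n\<ge>q. \<forall>m\<ge>M.
    (real n / real q) powr (2 / (1 + \<delta>)) / (2 * (real (card P))\<^sup>2) \<le> real (max_similar_copies P n m))"
proof -
  have "P \<noteq> {}" using assms by auto
  then obtain s where s: "real (card (affine_closure_step P (Suc s))) \<le>
      real (card (affine_closure_step P s)) powr (1 + \<delta>)"
    using ex_slow_growth_step assms by blast
  define A B where "A = affine_closure_step P (Suc s)" "B = affine_closure_step P s"
  define q b where "q = card A" "b = card B"
  \<comment> \<open>\<open>q + 1\<close> exceeds the at most \<open>card A\<close> points over one
    base point; 3 is needed for adding generic points.\<close>
  define M where "M = max (q + 1) 3"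
  have b2: "2 \<le> b" and q2: "2 \<le> q"
    unfolding q_b_def A_B_def
    by (intro card_affine_closure_step_ge_2 assms \<open>P \<noteq> {}\<close>)+
  have finA: "finite A" unfolding A_B_def by (rule affine_closure_step_finite_card(1)[OF assms(1)])
  have BA: "B \<subseteq> A"
    unfolding A_B_def by (rule affine_closure_step_subset_Suc[OF \<open>P \<noteq> {}\<close>])
  have cl: "a + z * p \<in> A" if "a \<in> B" "z \<in> B" "p \<in> P" for a z p
    using that unfolding A_B_def by force
  have qb: "real q \<le> real b powr (1 + \<delta>)" using s unfolding q_b_def A_B_def .
  have bound: "(real n / real q) powr (2 / (1 + \<delta>)) / (2 * (real (card P))\<^sup>2) \<le> real (max_similar_copies P n m)"
    if n: "q \<le> n" and m: "M \<le> m" for n m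
  proof -
    \<comment> \<open>The largest power of q not exceeding n; rounding down loses less than a factor
      q, hence n / q in the bound.\<close>
    obtain t where t: "q ^ t \<le> n" "n < q ^ (t + 1)"
      using ex_power_ivl1[OF q2, of n] n q2 by auto
    \<comment> \<open>This ensures \<open>b ^ t \<ge> 2\<close>, so \<open>b ^ t - 1\<close> is at
      least half of \<open>b ^ t\<close>; hence the 2 in the denominator of the bound.\<close>
    have "t \<noteq> 0" using t n by (intro notI) simp
    have "card A < M" "2 \<le> M" unfolding M_def q_b_def by auto
    then have "\<exists>Q R. finite Q \<and> R \<subseteq> Q \<and> card Q = q ^ t \<and> card R = b ^ t \<and> no_collinear M Q \<and>
        (\<forall>a\<in>R. \<forall>z\<in>R. \<forall>p\<in>P. a + z * p \<in> Q)"
      unfolding q_b_def by (intro ex_minkowski_power finA BA cl)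
    then obtain Q R where QR: "finite Q" "R \<subseteq> Q" "card Q = q ^ t" "card R = b ^ t" "no_collinear M Q"
      "\<And>a z p. a \<in> R \<Longrightarrow> z \<in> R \<Longrightarrow> p \<in> P \<Longrightarrow> a + z * p \<in> Q"
      by auto
    obtain Q' where Q': "Q \<subseteq> Q'" "finite Q'" "card Q' = n" "no_collinear M Q'"
      using ex_superset_no_collinear[OF QR(1,5)] t QR(3) unfolding M_def
      by (metis max.cobounded2)
    let ?k = "real (card P)"
    have "similar_copies P Q \<le> similar_copies P Q'"
      by (rule similar_copies_mono[OF Q'(2,1)])
    also have "\<dots> \<le> max_similar_copies P n m"
      using Q' no_collinear_mono[OF Q'(4) m] by (intro similar_copies_le_max) auto
    finally have le: "real (similar_copies P Q) \<le> real (max_similar_copies P n m)" by simp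
    have "finite R" using QR finite_subset by blast
    then have "b ^ t * (b ^ t - 1) \<le> similar_copies P Q * (card P)\<^sup>2"
      unfolding QR(4)[symmetric] by (intro similar_copies_ge assms QR)
    then have "real (b ^ t * (b ^ t - 1)) \<le> real (similar_copies P Q * (card P)\<^sup>2)"
      by (simp only: of_nat_le_iff)
    then have "real (b ^ t * (b ^ t - 1)) \<le> real (similar_copies P Q) * ?k\<^sup>2" by simp
    moreover have "b ^ 1 \<le> b ^ t" using b2 \<open>t \<noteq> 0\<close> by (intro power_increasing) auto
    then have bt: "2 \<le> b ^ t" using b2 by simp
    have "x\<^sup>2 \<le> 2 * (x * (x - 1))" if "2 \<le> x" for x :: nat
    proof -
      have "x * x \<le> x * (2 * (x - 1))" using that by (intro mult_left_mono) auto
      then show ?thesis by (simp add: power2_eq_square mult_ac)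
    qed
    then have "(b ^ t)\<^sup>2 \<le> 2 * (b ^ t * (b ^ t - 1))" using bt by blast
    then have "real ((b ^ t)\<^sup>2) \<le> real (2 * (b ^ t * (b ^ t - 1)))" by (simp only: of_nat_le_iff)
    then have "(real b ^ t)\<^sup>2 \<le> 2 * real (b ^ t * (b ^ t - 1))" by simp
    ultimately have copies: "(real b ^ t)\<^sup>2 \<le> 2 * ?k\<^sup>2 * real (similar_copies P Q)" by (simp add: mult_ac)
    have "real n \<le> real (q ^ (t + 1))" using t by (simp only: of_nat_le_iff)
    then have "real n / real q \<le> real q ^ t" using q2 by (simp add: field_simps)
    also have "\<dots> \<le> (real b powr (1 + \<delta>)) ^ t" using qb by (intro power_mono) auto
    also have "\<dots> = (real b ^ t) powr (1 + \<delta>)"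
      using b2 by (simp add: powr_powr powr_realpow[symmetric] mult.commute)
    finally have "(real n / real q) powr (2 / (1 + \<delta>)) \<le> ((real b ^ t) powr (1 + \<delta>)) powr (2 / (1 + \<delta>))"
      using assms(3) by (intro powr_mono2) auto
    also have "\<dots> = (real b ^ t) powr 2"
    proof -
      have "(1 + \<delta>) * (2 / (1 + \<delta>)) = 2" using assms(3) by (simp add: field_simps)
      then show ?thesis by (simp only: powr_powr)
    qed
    also have "\<dots> = (real b ^ t)\<^sup>2"
      using b2 by simp
    also have "\<dots> \<le> 2 * ?k\<^sup>2 * real (similar_copies P Q)" by (rule copies)
    also have "\<dots> \<le> 2 * ?k\<^sup>2 * real (max_similar_copies P n m)"
      using le by (intro mult_left_mono) auto
    finally show ?thesis
      using assms(2) by (simp add: field_simps)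
  qed
  show ?thesis using bound q2 by (intro exI[of _ M] exI[of _ q]) auto
qed

section \<open>Absorbing the constants for large n\<close>

theorem theorem7:
  fixes P :: "complex set" and m :: "nat \<Rightarrow> nat"
  assumes "finite P"
    and "card P \<ge> 3"
    and "\<And>n. m n \<ge> 3"
    and "filterlim m at_top sequentially"
  shows "\<forall>\<epsilon>::real. \<epsilon> > 0 \<longrightarrow>
    (\<exists>N\<^sub>0::nat. \<forall>n\<ge>N\<^sub>0. real (max_similar_copies P n (m n)) \<ge> real n powr (2 - \<epsilon>))"
proof (intro allI impI)
  fix \<epsilon> :: real assume \<epsilon>: "\<epsilon> > 0"
  obtain M q where q: "0 < q" and bound: "\<And>n m. q \<le> n \<Longrightarrow> M \<le> m \<Longrightarrow>
      (real n / real q) powr (2 / (1 + \<epsilon> / 2)) / (2 * (real (card P))\<^sup>2) \<le> real (max_similar_copies P n m)"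
    using ex_constant_collinearity_bound[of P "\<epsilon> / 2"] assms(1,2) \<epsilon> by auto
  define \<eta> where "\<eta> = 2 / (1 + \<epsilon> / 2)"
  define C where "C = 2 * (real (card P))\<^sup>2 * real q powr \<eta>"
  \<comment> \<open>Indeed (2 - \<epsilon>) (1 + \<epsilon>/2) = 2 - \<epsilon>^2/2 < 2. The strict
    gap leaves a positive power of n that eventually exceeds the constant \<open>C\<close>.\<close>
  have \<eta>: "2 - \<epsilon> < \<eta>"
    unfolding \<eta>_def using \<epsilon> by (simp add: field_simps)
  have C: "0 < C" unfolding C_def using q assms(2) by simp
  have "eventually (\<lambda>n. C \<le> real n powr (\<eta> - (2 - \<epsilon>))) sequentially"
    using \<eta> C by real_asymp
  moreover have "eventually (\<lambda>n. M \<le> m n) sequentially"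
    using assms(4) by (simp add: filterlim_at_top)
  moreover have "eventually (\<lambda>n. q \<le> n) sequentially" by (rule eventually_ge_at_top)
  ultimately have "eventually (\<lambda>n. real n powr (2 - \<epsilon>) \<le> real (max_similar_copies P n (m n))) sequentially"
  proof eventually_elim
    case (elim n)
    have "real n powr (2 - \<epsilon>) * C \<le> real n powr (2 - \<epsilon>) * real n powr (\<eta> - (2 - \<epsilon>))"
      using elim by (intro mult_left_mono) auto
    also have "\<dots> = real n powr \<eta>" by (simp add: powr_add[symmetric])
    finally have "real n powr (2 - \<epsilon>) \<le> real n powr \<eta> / C" using C by (simp add: field_simps)
    also have "\<dots> = (real n / real q) powr \<eta> / (2 * (real (card P))\<^sup>2)"
      unfolding C_def by (simp add: powr_divide)
    also have "\<dots> \<le> real (max_similar_copies P n (m n))"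
      using bound[of n "m n"] elim unfolding \<eta>_def by blast
    finally show ?case .
  qed
  then show "\<exists>N\<^sub>0::nat. \<forall>n\<ge>N\<^sub>0. real (max_similar_copies P n (m n)) \<ge> real n powr (2 - \<epsilon>)"
    by (simp add: eventually_sequentially)
qed

end
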